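(* Let $B_{1,h}^I(x,t)$ and $B_{1,h}^J(x,t)$ denote the fifth components of the numerical solutions $\bm U_h^I(x,t)$ and $\bm U_h^J(x,t)$ of the 1D fully discrete central discontinuous Galerkin (CDG) scheme with a strong-stability-preserving (SSP) time discretization. The scheme exactly preserves the 1D divergence-free constraint: if the initial numerical data satisfy $B_{1,h}^I(x,t_0)=B_{const}=B_{1,h}^J(x,t_0)$ for all $x$ with a constant $B_{const}$, then $$B_{1,h}^I(x,t_n)=B_{const}=B_{1,h}^J(x,t_n)\qquad\forall x,\ \forall n\ge0,$$ where $t_n$ is the $n$th time level.
   Context: **RMHD flux.** States are $\bm U=(D,\bm m,\bm B,E)^\top\in\mathbb R^8$, $\bm m=(m_1,m_2,m_3)$, $\bm B=(B_1,B_2,B_3)$, related to primitive variables $(\rho,\bm v,\bm B,p)$ by $D=\rho W$, $m_i=\rho hW^2v_i+|\bm B|^2v_i-(\bm v\cdot\bm B)B_i$, $E=\rho hW^2-p_{tot}+|\bm B|^2$, with $W=(1-|\bm v|^2)^{-1/2}$, $p_{tot}=p+\frac12((1-|\bm v|^2)|\bm B|^2+(\bm v\cdot\bm B)^2)$ and $h=h(p,\rho)$ a given equation of state. The flux is $\bm F_1(\bm U)=\big(Dv_1,\ v_1\bm m-B_1(W^{-2}\bm B+(\bm v\cdot\bm B)\bm v)+p_{tot}\bm e_1,\ v_1\bm B-B_1\bm v,\ m_1\big)^\top$, $\bm e_1=(1,0,0)$. The numerical states are assumed to be such that the fluxes appearing in the scheme are well defined. **Meshes and spaces.** Uniform primal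 mesh $I_j=(x_{j-\frac12},x_{j+\frac12})$ of size $\Delta x$, centers $x_j$; dual mesh $J_{j+\frac12}=(x_j,x_{j+1})$. $x_{j\pm\frac14}=x_j\pm\frac14\Delta x$. $\bm U_h^I(\cdot,t)$ and $\bm U_h^J(\cdot,t)$ are $\mathbb R^8$-valued with components in $\mathbb P^k(I_j)$ on each $I_j$, resp. in $\mathbb P^k(J_{j+\frac12})$ on each $J_{j+\frac12}$. With local orthogonal polynomial bases $\{\Psi_j^{(\ell)}\}_{\ell=0}^k$ of $\mathbb P^k(I_j)$ and $\{\Psi_{j+\frac12}^{(\ell)}\}_{\ell=0}^k$ of $\mathbb P^k(J_{j+\frac12})$ ($\ell=0$ the constant $1$), write $\bm U_h^I=\sum_\ell\bm U_j^{I,(\ell)}(t)\Psi_j^{(\ell)}(x)$ on $I_j$ and $\bm U_h^J=\sum_\ell\bm U_{j+\frac12}^{J,(\ell)}(t)\Psi_{j+\frac12}^{(\ell)}(x)$ on $J_{j+\frac12}$. **Semi-discrete CDG scheme.** Let $Q=k+1$, $\{x_{j\pm\frac14}^\mu\}_{\mu=1}^Q$ the Gauss nodes in $[x_{j\pm\frac14}-\frac{\Delta x}4,x_{j\pm\frac14}+\frac{\Delta x}4]$, weights $\omega_\mu$ with $\sum_\mu\omega_\mu=1$, $a_j^{(\ell)}=\frac1{\Delta x}\int_{I_j}(\Psi_j^{(\ell)})^2dx$, and $\tau_{\max}>0$ a parameter. For $\ell=0,\dots,k$ and all $j$, $$a_j^{(\ell)}\frac{d\bm U_j^{I,(\ell)}}{dt}=\frac1{\tau_{\max}\Delta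 x}\int_{I_j}(\bm U_h^J-\bm U_h^I)\Psi_j^{(\ell)}dx+\sum_{m=\pm1}\sum_{\mu=1}^Q\frac{\omega_\mu}2\bm F_1(\bm U_h^J(x_{j+\frac m4}^\mu,t))\frac{d\Psi_j^{(\ell)}}{dx}(x_{j+\frac m4}^\mu)+\frac1{\Delta x}\Big(\bm F_1(\bm U_h^J(x_{j-\frac12},t))\Psi_j^{(\ell)}(x_{j-\frac12}^+)-\bm F_1(\bm U_h^J(x_{j+\frac12},t))\Psi_j^{(\ell)}(x_{j+\frac12}^-)\Big),$$ and the equation for $\bm U_{j+\frac12}^{J,(\ell)}$ is the same with the roles of $I$ and $J$ exchanged and all indices shifted by $\frac12$. This is an ODE system $\frac{d\bm U}{dt}=\mathcal L(\bm U)$ for all degrees of freedom. **SSP time discretization.** An explicit Runge–Kutta or multistep method in which each new stage/level is a convex combination of forward Euler steps $\bm V+c\,\Delta t\,\mathcal L(\bm V)$ ($c\ge0$) applied to previously computed stages/levels $\bm V$; e.g. the third-order SSP Runge–Kutta method $\bm U^{[1]}=\bm U^n+\Delta t\mathcal L(\bm U^n)$, $\bm U^{[2]}=\frac34\bm U^n+\frac14(\bm U^{[1]}+\Delta t\mathcal L(\bm U^{[1]}))$, $\bm U^{n+1}=\frac13\bm U^n+\frac23(\bm U^{[2]}+\Delta t\mathcal L(\bm U^{[2]}))$, or the third-order SSP multistep method $\bm U^{n+1}=\frac{16}{27}(\bm U^n+3\Delta t\mathcal L(\bm U^n))+\frac{11}{27}(\bm U^{n-3}+\frac{12}{11}\Delta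 t\mathcal L(\bm U^{n-3}))$. For multistep methods, the initial numerical data comprise all starting levels. *)

theory Defs
  imports "HOL-Analysis.Analysis" "HOL-Computational_Algebra.Polynomial"
begin

text \<open>RMHD states and flux. Conservative states are vectors
  \<open>(D, m\<^sub>1, m\<^sub>2, m\<^sub>3, B\<^sub>1, B\<^sub>2, B\<^sub>3, E)\<close> in \<open>real^8\<close>, so that component 5 is \<open>B\<^sub>1\<close>.
  An equation of state is a function \<open>h p \<rho>\<close>.\<close>

type_synonym state = "real^8"

record prim =
  rho :: real
  vel :: "real^3"
  mag :: "real^3"
  pre :: real

definition physical :: "prim \<Rightarrow> bool" where
  "physical w \<longleftrightarrow> rho w > 0 \<and> pre w > 0 \<and> norm (vel w) < 1"

definition lorentz :: "prim \<Rightarrow> real" where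
  "lorentz w = 1 / sqrt (1 - (norm (vel w))\<^sup>2)"

definition p_tot :: "prim \<Rightarrow> real" where
  "p_tot w = pre w + ((1 - (norm (vel w))\<^sup>2) * (norm (mag w))\<^sup>2 + (vel w \<bullet> mag w)\<^sup>2) / 2"

definition momentum :: "(real \<Rightarrow> real \<Rightarrow> real) \<Rightarrow> prim \<Rightarrow> real^3" where
  "momentum h w =
     (rho w * h (pre w) (rho w) * (lorentz w)\<^sup>2 + (norm (mag w))\<^sup>2) *\<^sub>R vel w
     - (vel w \<bullet> mag w) *\<^sub>R mag w"

definition energy :: "(real \<Rightarrow> real \<Rightarrow> real) \<Rightarrow> prim \<Rightarrow> real" where
  "energy h w = rho w * h (pre w) (rho w) * (lorentz w)\<^sup>2 - p_tot w + (norm (mag w))\<^sup>2"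

definition conservative :: "(real \<Rightarrow> real \<Rightarrow> real) \<Rightarrow> prim \<Rightarrow> state" where
  "conservative h w = (let m = momentum h w; B = mag w in
     vector [rho w * lorentz w, m$1, m$2, m$3, B$1, B$2, B$3, energy h w])"

definition prim_flux :: "(real \<Rightarrow> real \<Rightarrow> real) \<Rightarrow> prim \<Rightarrow> state" where
  "prim_flux h w = (let v = vel w; B = mag w; m = momentum h w;
       M = v$1 *\<^sub>R m - B$1 *\<^sub>R ((1 / (lorentz w)\<^sup>2) *\<^sub>R B + (v \<bullet> B) *\<^sub>R v) + p_tot w *\<^sub>R axis 1 1;
       b = v$1 *\<^sub>R B - B$1 *\<^sub>R v in
     vector [rho w * lorentz w * v$1, M$1, M$2, M$3, b$1, b$2, b$3, m$1])"

text \<open>The flux of a conservative state is computed from the primitive variables recovered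
  from it; it is well defined when there is exactly one physical primitive state to recover.\<close>

definition flux_defined :: "(real \<Rightarrow> real \<Rightarrow> real) \<Rightarrow> state \<Rightarrow> bool" where
  "flux_defined h u \<longleftrightarrow> (\<exists>!w. physical w \<and> conservative h w = u)"

definition F1 :: "(real \<Rightarrow> real \<Rightarrow> real) \<Rightarrow> state \<Rightarrow> state" where
  "F1 h u = prim_flux h (THE w. physical w \<and> conservative h w = u)"

text \<open>Both meshes are treated uniformly: \<open>Primal\<close> cells \<open>I\<^sub>j\<close> have centre \<open>x\<^sub>j\<close>, and the
  \<open>Dual\<close> cell with index \<open>j\<close> is \<open>J\<^bsub>j+1/2\<^esub>\<close>. Cells are indexed by all integers.\<close>

datatype mesh = Primal | Dual

fun other :: "mesh \<Rightarrow> mesh" where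
  "other Primal = Dual"
| "other Dual = Primal"

fun shift :: "mesh \<Rightarrow> real" where
  "shift Primal = 0"
| "shift Dual = 1/2"

record cdg =
  eos :: "real \<Rightarrow> real \<Rightarrow> real"
  origin :: real                                   \<comment> \<open>the point \<open>x\<^sub>0\<close>\<close>
  dx :: real
  deg :: nat                                       \<comment> \<open>the degree \<open>k\<close>\<close>
  basis :: "mesh \<Rightarrow> int \<Rightarrow> nat \<Rightarrow> real poly"
  gauss_node :: "nat \<Rightarrow> real"                       \<comment> \<open>on the reference interval \<open>[-1,1]\<close>\<close>
  gauss_weight :: "nat \<Rightarrow> real"
  tau_max :: real

definition grid :: "cdg \<Rightarrow> real \<Rightarrow> real" where  \<comment> \<open>\<open>x\<^sub>s\<close> for a possibly fractional index \<open>s\<close>\<close>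
  "grid S s = origin S + s * dx S"

definition idx :: "mesh \<Rightarrow> int \<Rightarrow> real" where
  "idx M j = of_int j + shift M"

definition cell :: "cdg \<Rightarrow> mesh \<Rightarrow> int \<Rightarrow> real set" where
  "cell S M j = {grid S (idx M j - 1/2) <..< grid S (idx M j + 1/2)}"

definition orthogonal_basis :: "nat \<Rightarrow> real set \<Rightarrow> (nat \<Rightarrow> real poly) \<Rightarrow> bool" where
  "orthogonal_basis k C \<psi> \<longleftrightarrow>
     inj_on \<psi> {..k} \<and>
     \<not> module.dependent smult (\<psi> ` {..k}) \<and>
     module.span smult (\<psi> ` {..k}) = {p. degree p \<le> k} \<and>
     (\<forall>l\<le>k. \<forall>m\<le>k. l \<noteq> m \<longrightarrow> integral C (\<lambda>x. poly (\<psi> l) x * poly (\<psi> m) x) = 0)"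

text \<open>The \<open>Q\<close>-point Gauss rule on \<open>[-1,1]\<close>, with weights normalised to sum 1; it is the unique
  \<open>Q\<close>-point rule that is exact for polynomials of degree less than \<open>2Q\<close>.\<close>

definition gauss_rule :: "nat \<Rightarrow> (nat \<Rightarrow> real) \<Rightarrow> (nat \<Rightarrow> real) \<Rightarrow> bool" where
  "gauss_rule Q \<xi> \<omega> \<longleftrightarrow>
     strict_mono_on {1..Q} \<xi> \<and> \<xi> ` {1..Q} \<subseteq> {-1..1} \<and> (\<Sum>\<mu>=1..Q. \<omega> \<mu>) = 1 \<and>
     (\<forall>p::real poly. degree p < 2 * Q \<longrightarrow>
        (\<Sum>\<mu>=1..Q. \<omega> \<mu> * poly p (\<xi> \<mu>)) = integral {-1..1} (poly p) / 2)"

definition valid_cdg :: "cdg \<Rightarrow> bool" where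
  "valid_cdg S \<longleftrightarrow> dx S > 0 \<and> tau_max S > 0 \<and>
     (\<forall>M j. orthogonal_basis (deg S) (cell S M j) (basis S M j) \<and> basis S M j 0 = 1) \<and>
     gauss_rule (deg S + 1) (gauss_node S) (gauss_weight S)"

text \<open>Degrees of freedom: \<open>V M j l\<close> is the coefficient of the \<open>l\<close>-th basis polynomial in cell
  \<open>j\<close> of mesh \<open>M\<close>; only \<open>l \<le> k\<close> is relevant.\<close>

type_synonym dofs = "mesh \<Rightarrow> int \<Rightarrow> nat \<Rightarrow> state"

text \<open>The numerical solution as a function of \<open>x\<close>. At an interface of the mesh \<open>M\<close> the
  value from the right is taken; \<open>cdg_rhs\<close> never evaluates the solution at such points
  (except on null sets of integration).\<close>

definition cell_index :: "cdg \<Rightarrow> mesh \<Rightarrow> real \<Rightarrow> int" where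
  "cell_index S M x = \<lfloor>(x - origin S) / dx S - shift M + 1/2\<rfloor>"

definition solution :: "cdg \<Rightarrow> dofs \<Rightarrow> mesh \<Rightarrow> real \<Rightarrow> state" where
  "solution S V M x = (let j = cell_index S M x in
     \<Sum>l\<le>deg S. poly (basis S M j l) x *\<^sub>R V M j l)"

text \<open>The \<open>\<mu>\<close>-th Gauss node in the half cell centred at \<open>x\<^bsub>s+m/4\<^esub>\<close>, \<open>m = \<plusminus>1\<close>, where
  \<open>s\<close> is the index of the centre of cell \<open>j\<close>.\<close>

definition quad_pt :: "cdg \<Rightarrow> mesh \<Rightarrow> int \<Rightarrow> int \<Rightarrow> nat \<Rightarrow> real" where
  "quad_pt S M j m \<mu> = grid S (idx M j + of_int m / 4) + dx S / 4 * gauss_node S \<mu>"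

definition mass :: "cdg \<Rightarrow> mesh \<Rightarrow> int \<Rightarrow> nat \<Rightarrow> real" where
  "mass S M j l = integral (cell S M j) (\<lambda>x. (poly (basis S M j l) x)\<^sup>2) / dx S"

text \<open>The operator \<open>\<L>\<close> of the semi-discrete scheme \<open>dU/dt = \<L>(U)\<close>.\<close>

definition cdg_rhs :: "cdg \<Rightarrow> dofs \<Rightarrow> dofs" where
  "cdg_rhs S V M j l =
     (let \<psi> = basis S M j l;
          own = solution S V M;
          dual = solution S V (other M);
          F = F1 (eos S);
          xl = grid S (idx M j - 1/2);
          xr = grid S (idx M j + 1/2) in
      (1 / mass S M j l) *\<^sub>R
        ((1 / (tau_max S * dx S)) *\<^sub>R integral (cell S M j) (\<lambda>x. poly \<psi> x *\<^sub>R (dual x - own x))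
         + (\<Sum>m\<in>{-1,1}. \<Sum>\<mu>=1..deg S + 1.
              (gauss_weight S \<mu> / 2 * poly (pderiv \<psi>) (quad_pt S M j m \<mu>)) *\<^sub>R
                F (dual (quad_pt S M j m \<mu>)))
         + (1 / dx S) *\<^sub>R (poly \<psi> xl *\<^sub>R F (dual xl) - poly \<psi> xr *\<^sub>R F (dual xr))))"

text \<open>All fluxes appearing in \<open>\<L>(V)\<close> are well defined.\<close>

definition fluxes_defined :: "cdg \<Rightarrow> dofs \<Rightarrow> bool" where
  "fluxes_defined S V \<longleftrightarrow>
     (\<forall>M j. \<forall>x \<in> {grid S (idx M j - 1/2), grid S (idx M j + 1/2)}
                \<union> {quad_pt S M j m \<mu> | m \<mu>. m \<in> {-1,1} \<and> \<mu> \<in> {1..deg S + 1}}.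
        flux_defined (eos S) (solution S V (other M) x))"

text \<open>An explicit SSP method using \<open>r\<close> old time levels and \<open>s\<close> stages per step. In step \<open>n\<close>,
  the vectors \<open>V n 0, \<dots>, V n (r-1)\<close> are the levels \<open>n, \<dots>, n+r-1\<close>; each stage
  \<open>V n r, \<dots>, V n (r+s-1)\<close> is a convex combination of forward Euler steps from
  vectors with smaller index, and the last one is the new level \<open>n+r\<close>. Runge-Kutta methods
  are the case \<open>r = 1\<close>, multistep methods the case \<open>s = 1\<close>. The coefficients may depend
  on the step, as they do for multistep methods with variable step sizes.\<close>

definition ssp_method ::
  "nat \<Rightarrow> nat \<Rightarrow> (nat \<Rightarrow> nat \<Rightarrow> nat \<Rightarrow> real) \<Rightarrow> (nat \<Rightarrow> nat \<Rightarrow> nat \<Rightarrow> real) \<Rightarrow> bool" where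
  "ssp_method r s \<alpha> c \<longleftrightarrow> r \<ge> 1 \<and> s \<ge> 1 \<and>
     (\<forall>n. \<forall>i\<in>{r..<r+s}. (\<forall>m<i. \<alpha> n i m \<ge> 0 \<and> c n i m \<ge> 0) \<and> (\<Sum>m<i. \<alpha> n i m) = 1)"

definition forward_euler :: "cdg \<Rightarrow> real \<Rightarrow> dofs \<Rightarrow> dofs" where
  "forward_euler S dt V M j l = V M j l + dt *\<^sub>R cdg_rhs S V M j l"

text \<open>\<open>t n\<close> is the \<open>n\<close>-th time level and \<open>U n\<close> the numerical solution there.\<close>

definition fully_discrete_cdg ::
  "cdg \<Rightarrow> nat \<Rightarrow> nat \<Rightarrow> (nat \<Rightarrow> nat \<Rightarrow> nat \<Rightarrow> real) \<Rightarrow> (nat \<Rightarrow> nat \<Rightarrow> nat \<Rightarrow> real) \<Rightarrow>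
   (nat \<Rightarrow> real) \<Rightarrow> (nat \<Rightarrow> nat \<Rightarrow> dofs) \<Rightarrow> (nat \<Rightarrow> dofs) \<Rightarrow> bool" where
  "fully_discrete_cdg S r s \<alpha> c t V U \<longleftrightarrow>
     (\<forall>n. (\<forall>q<r. V n q = U (n + q)) \<and>
          (\<forall>i\<in>{r..<r+s}. \<forall>M j. \<forall>l\<le>deg S.
             V n i M j l = (\<Sum>m<i. \<alpha> n i m *\<^sub>R
               forward_euler S (c n i m * (t (n + r) - t (n + r - 1))) (V n m) M j l)) \<and>
          U (n + r) = V n (r + s - 1))"

text \<open>Only the vectors to which \<open>\<L>\<close> is actually applied need well-defined fluxes.\<close>

definition scheme_fluxes_defined ::
  "cdg \<Rightarrow> nat \<Rightarrow> nat \<Rightarrow> (nat \<Rightarrow> nat \<Rightarrow> nat \<Rightarrow> real) \<Rightarrow> (nat \<Rightarrow> nat \<Rightarrow> nat \<Rightarrow> real) \<Rightarrow>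
   (nat \<Rightarrow> nat \<Rightarrow> dofs) \<Rightarrow> bool" where
  "scheme_fluxes_defined S r s \<alpha> c V \<longleftrightarrow>
     (\<forall>n. \<forall>i\<in>{r..<r+s}. \<forall>m<i. \<alpha> n i m * c n i m \<noteq> 0 \<longrightarrow> fluxes_defined S (V n m))"

end

theory Submission
  imports Defs
begin

text \<open>The first component of the flux for \<open>B\<close> is \<open>v\<^sub>1 B\<^sub>1 - B\<^sub>1 v\<^sub>1 = 0\<close>. In the discrete
  equation for \<open>B\<^sub>1\<close> this leaves only the coupling integral of \<open>U\<^sub>h\<^sup>J - U\<^sub>h\<^sup>I\<close>, which vanishes when
  \<open>B\<^sub>1\<close> is the same constant on both meshes. So \<open>\<L>\<close> does not change \<open>B\<^sub>1\<close>, and convex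
  combinations of forward Euler steps keep it constant. Since the basis polynomials are linearly
  independent, \<open>B\<^sub>1\<close> is constant exactly when its coefficients are those of a constant.\<close>

lemma vector_8_nth_5:
  "(vector [a1, a2, a3, a4, a5, a6, a7, a8] :: ('a::zero)^8) $ 5 = a5"
  by (simp add: vector_def)

lemma F1_nth_5 [simp]: "F1 h u $ 5 = 0"
  by (simp add: F1_def prim_flux_def Let_def vector_8_nth_5)

text \<open>Taking a component is a bounded linear map, so it commutes with the integral of an
  integrable function. A non-integrable function has integral 0 by convention, so both cases
  agree.\<close>

lemma integral_eq_0_component:
  fixes f :: "'a::euclidean_space \<Rightarrow> real^'n"
  assumes "\<And>x. f x $ i = 0"
  shows "integral A f $ i = 0"
proof (cases "f integrable_on A")
  case True
  then have "((\<lambda>x. f x $ i) has_integral integral A f $ i) A"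
    using has_integral_linear[OF integrable_integral[OF True] bounded_linear_vec_nth]
    by (simp add: o_def)
  then show ?thesis
    using assms by (simp add: has_integral_unique[OF _ has_integral_0])
next
  case False
  then show ?thesis
    by (simp add: not_integrable_integral)
qed

lemma cdg_rhs_nth_5:
  assumes "\<And>M x. solution S V M x $ 5 = b"
  shows "cdg_rhs S V M j l $ 5 = 0"
  by (simp add: cdg_rhs_def Let_def integral_eq_0_component assms)

text \<open>Constancy is put on the coefficients because the time stepping acts on them. Stages are
  only prescribed for \<open>l \<le> deg S\<close>, hence the same bound here.\<close>

definition const_B1 :: "cdg \<Rightarrow> real \<Rightarrow> dofs \<Rightarrow> bool" where
  "const_B1 S b V \<longleftrightarrow> (\<forall>M j. \<forall>l\<le>deg S. V M j l $ 5 = (if l = 0 then b else 0))"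

lemma solution_nth_5_if_const_B1:
  assumes "valid_cdg S" "const_B1 S b V"
  shows "solution S V M x $ 5 = b"
proof -
  define j where "j = cell_index S M x"
  have "basis S M j 0 = 1"
    using assms(1) by (simp add: valid_cdg_def)
  have "solution S V M x $ 5 = (\<Sum>l\<le>deg S. poly (basis S M j l) x * V M j l $ 5)"
    by (simp add: solution_def Let_def j_def)
  also have "\<dots> = (\<Sum>l\<le>deg S. if l = 0 then b else 0)"
    using assms(2) \<open>basis S M j 0 = 1\<close> by (intro sum.cong) (auto simp: const_B1_def)
  finally show ?thesis
    by simp
qed

text \<open>Inside the open cell the argument of the floor lies strictly between \<open>j\<close>
  and \<open>j + 1\<close>. Thus \<open>solution\<close> is there a single polynomial.\<close>

lemma cell_index_eq:
  assumes "dx S > 0" "x \<in> cell S M j"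
  shows "cell_index S M x = j"
proof -
  have "(x - origin S) / dx S > idx M j - 1/2" "(x - origin S) / dx S < idx M j + 1/2"
    using assms by (auto simp: cell_def grid_def field_simps)
  then show ?thesis
    by (simp add: cell_index_def idx_def floor_eq_iff)
qed

text \<open>On each cell the fifth component minus \<open>b\<close> is a polynomial with infinitely
  many zeros, hence the zero polynomial; linear independence then kills its coefficients.\<close>

lemma const_B1_if_solution_nth_5:
  assumes "valid_cdg S" "\<And>M x. solution S V M x $ 5 = b"
  shows "const_B1 S b V"
  unfolding const_B1_def
proof (intro allI impI)
  fix M j l assume l: "l \<le> deg S"
  interpret vector_space "smult :: real \<Rightarrow> real poly \<Rightarrow> real poly"
    by unfold_locales (simp_all add: smult_add_right smult_add_left)
  define \<psi> where "\<psi> = basis S M j"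
  \<comment> \<open>Since \<open>\<psi> 0 = 1\<close>, the constant \<open>b\<close> has coefficient
    \<open>b\<close> at index 0, so these are the coefficients of the difference.\<close>
  define a where "a l = V M j l $ 5 - (if l = 0 then b else 0)" for l
  define p where "p = (\<Sum>l\<le>deg S. smult (a l) (\<psi> l))"
  have dx: "dx S > 0" and basis: "inj_on \<psi> {..deg S}" "independent (\<psi> ` {..deg S})"
    and \<psi>0: "\<psi> 0 = 1"
    using assms(1) by (auto simp: valid_cdg_def orthogonal_basis_def \<psi>_def)
  have "poly p x = 0" if "x \<in> cell S M j" for x
  proof -
    have "(\<Sum>l\<le>deg S. poly (\<psi> l) x * V M j l $ 5) = b"
      using assms(2)[of M x] cell_index_eq[OF dx that]
      by (simp add: solution_def Let_def \<psi>_def)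
    moreover have "(\<Sum>l\<le>deg S. poly (\<psi> l) x * (if l = 0 then b else 0)) = b"
      using \<psi>0 by (simp add: if_distrib[of "\<lambda>y. _ * y"] cong: if_cong)
    ultimately show ?thesis
      by (simp add: p_def a_def poly_sum mult.commute right_diff_distrib sum_subtractf)
  qed
  then have "cell S M j \<subseteq> {x. poly p x = 0}"
    by blast
  moreover have "infinite (cell S M j)"
    using dx by (simp add: cell_def grid_def algebra_simps)
  ultimately have "p = 0"
    using poly_roots_finite finite_subset by blast
  \<comment> \<open>Independence concerns a set of polynomials, so the sum is reindexed over the
    image; injectivity recovers the index from the polynomial.\<close>
  moreover have "p = (\<Sum>q\<in>\<psi> ` {..deg S}. smult (a (the_inv_into {..deg S} \<psi> q)) q)"
    using basis(1) by (simp add: p_def sum.reindex the_inv_into_f_f)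
  ultimately have "a (the_inv_into {..deg S} \<psi> (\<psi> l)) = 0"
    using independentD[OF basis(2), of "\<psi> ` {..deg S}" "\<lambda>q. a (the_inv_into {..deg S} \<psi> q)"] l
    by auto
  then have "a l = 0"
    using basis(1) l by (simp add: the_inv_into_f_f)
  then show "V M j l $ 5 = (if l = 0 then b else 0)"
    by (simp add: a_def)
qed

lemma const_B1_forward_euler:
  assumes "valid_cdg S" "const_B1 S b V"
  shows "const_B1 S b (forward_euler S d V)"
  using assms(2) cdg_rhs_nth_5[of S V b] solution_nth_5_if_const_B1[OF assms]
  by (simp add: const_B1_def forward_euler_def)

text \<open>The conditions are affine in the coefficients, so they survive combinations whose
  weights sum to 1.\<close>

lemma const_B1_convex_combination:
  assumes "\<And>m. m < i \<Longrightarrow> const_B1 S b (V m)" "(\<Sum>m<i. a m) = 1"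
    and "\<And>M j l. l \<le> deg S \<Longrightarrow> W M j l = (\<Sum>m<i. a m *\<^sub>R V m M j l)"
  shows "const_B1 S b W"
  unfolding const_B1_def
proof (intro allI impI)
  fix M j l assume l: "l \<le> deg S"
  have "W M j l $ 5 = (\<Sum>m<i. a m * V m M j l $ 5)"
    using assms(3)[OF l] by simp
  also have "\<dots> = (\<Sum>m<i. a m * (if l = 0 then b else 0))"
    using assms(1) l by (intro sum.cong) (auto simp: const_B1_def)
  also have "\<dots> = (if l = 0 then b else 0)"
    using assms(2) by (simp flip: sum_distrib_right)
  finally show "W M j l $ 5 = (if l = 0 then b else 0)" .
qed

text \<open>Induction over the vectors of one step: those below \<open>r\<close> are old levels, and
  each stage is built only from vectors of smaller index.\<close>

lemma const_B1_step:
  assumes "valid_cdg S" "ssp_method r s \<alpha> c" "fully_discrete_cdg S r s \<alpha> c t V U"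
    and old: "\<And>q. q < r \<Longrightarrow> const_B1 S b (U (n + q))"
  shows "const_B1 S b (U (n + r))"
proof -
  have "const_B1 S b (V n i)" if "i < r + s" for i
    using that
  proof (induction i rule: less_induct)
    case (less i)
    show ?case
    proof (cases "i < r")
      case True
      then show ?thesis
        using assms(3) old by (simp add: fully_discrete_cdg_def)
    next
      case False
      with less.prems have i: "i \<in> {r..<r+s}"
        by simp
      let ?W = "\<lambda>m. forward_euler S (c n i m * (t (n + r) - t (n + r - 1))) (V n m)"
      show ?thesis
      proof (rule const_B1_convex_combination)
        show "const_B1 S b (?W m)" if "m < i" for m
          using less that by (intro const_B1_forward_euler assms(1)) auto
        show "(\<Sum>m<i. \<alpha> n i m) = 1"
          using assms(2) i unfolding ssp_method_def by blast
        show "V n i M j l = (\<Sum>m<i. \<alpha> n i m *\<^sub>R ?W m M j l)" if "l \<le> deg S" for M j l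
          using assms(3) i that unfolding fully_discrete_cdg_def by blast
      qed
    qed
  qed
  \<comment> \<open>With \<open>s \<ge> 1\<close> the index \<open>r + s - 1\<close> of the new
    level lies below \<open>r + s\<close>.\<close>
  moreover have "U (n + r) = V n (r + s - 1)" "s \<ge> 1"
    using assms(2,3) by (auto simp: fully_discrete_cdg_def ssp_method_def)
  ultimately show ?thesis
    by simp
qed

theorem lemma3p1:
  fixes S :: cdg and r s :: nat
    and \<alpha> c :: "nat \<Rightarrow> nat \<Rightarrow> nat \<Rightarrow> real"
    and t :: "nat \<Rightarrow> real"
    and V :: "nat \<Rightarrow> nat \<Rightarrow> dofs" and U :: "nat \<Rightarrow> dofs"
    and B_const :: real
  assumes "valid_cdg S"
    and "ssp_method r s \<alpha> c"
    and "strict_mono t"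
    and "fully_discrete_cdg S r s \<alpha> c t V U"
    and "scheme_fluxes_defined S r s \<alpha> c V"
    and "\<And>q x. q < r \<Longrightarrow>
           solution S (U q) Primal x $ 5 = B_const \<and> solution S (U q) Dual x $ 5 = B_const"
  shows "\<forall>n x. solution S (U n) Primal x $ 5 = B_const \<and> solution S (U n) Dual x $ 5 = B_const"
proof -
  have start: "const_B1 S B_const (U q)" if "q < r" for q
  proof (rule const_B1_if_solution_nth_5[OF assms(1)])
    show "solution S (U q) M x $ 5 = B_const" for M x
      using assms(6)[OF that] by (cases M) auto
  qed
  have "const_B1 S B_const (U n)" for n
  proof (induction n rule: less_induct)
    case (less n)
    show ?case
    proof (cases "n < r")
      case False
      \<comment> \<open>Level \<open>n\<close> is produced by step \<open>n - r\<close>, which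
        starts from the \<open>r\<close> levels just before \<open>n\<close>; hence strong
        induction.\<close>
      have "const_B1 S B_const (U (n - r + q))" if "q < r" for q
        using less False that by simp
      then have "const_B1 S B_const (U (n - r + r))"
        using assms(1,2,4) by (rule const_B1_step[rotated 3])
      then show ?thesis
        using False by simp
    qed (rule start)
  qed
  then show ?thesis
    using solution_nth_5_if_const_B1[OF assms(1)] by blast
qed

end
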